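(* Let $(M,\|\cdot\|)$ be a Minkowski plane, let $x_1,x_2,x_3\in M$, and let $p_4\in\mathcal{C}(\triangle x_1x_2x_3)$. Let $m_1,m_2,m_3$ be the midpoints of $[x_2,x_3]$, $[x_1,x_3]$, $[x_1,x_2]$ respectively, let $p_i=S_{m_i}(p_4)$ for $i=1,2,3$ (so that $\triangle p_1p_2p_3$ is the $p_4$-antitriangle of $\triangle x_1x_2x_3$), let $q=\frac{x_1+x_2+x_3-p_4}{2}$ and $x_4=S_q(p_4)$. Let $d_1,d_2,d_3$ be the midpoints of the sides $[p_2,p_3]$, $[p_1,p_3]$, $[p_1,p_2]$ of the $p_4$-antitriangle respectively. Then: 1. $\{x_1,x_2,x_3,x_4\}$ and $\{p_1,p_2,p_3,p_4\}$ are $\mathcal{C}$-orthocentric systems. 2. The points $d_1,d_2,d_3$ are the midpoints of the segments joining the vertices of $\triangle x_1x_2x_3$ with its $\mathcal{C}$-orthocenter $x_4$, i.e. $d_i=\frac{x_i+x_4}{2}$ for $i=1,2,3$. 3. The midpoints $m_1,m_2,m_3$ of the sides of $\triangle x_1x_2x_3$ and the midpoints $d_1,d_2,d_3$ of the sides of its $p_4$-antitriangle all lie on the circle with center $q$ and radius $\|q-m_1\|$.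
   Context: A Minkowski plane is a real two-dimensional normed linear space. The circle with center $x$ and radius $\lambda$ is $\{w\in M:\|w-x\|=\lambda\}$. $S_p(w)=2p-w$ is the symmetry with center $p$. For points $a,b,c\in M$, the set of circumcenters is $\mathcal{C}(\triangle abc)=\{x\in M:\|x-a\|=\|x-b\|=\|x-c\|\}$. $\mathcal{C}$-orthocenter: given points $a,b,c\in M$ and $o\in\mathcal{C}(\triangle abc)$, put $q=\frac{a+b+c-o}{2}$, which is the point of symmetry between $\triangle abc$ and its $o$-antitriangle, i.e. the triangle whose vertices are the images of $o$ under the symmetries at the midpoints of the sides $[b,c],[a,c],[a,b]$. The $\mathcal{C}$-orthocenter of $\triangle abc$ associated with $o$ is $S_q(o)=a+b+c-2o$. $\mathcal{C}$-orthocentric system: four points $p_1,p_2,p_3,p_4\in M$ form a $\mathcal{C}$-orthocentric system $\{p_1,p_2,p_3,p_4\}$ if for some labeling $\{i,j,k,l\}=\{1,2,3,4\}$ there is a circumcenter $x_i\in\mathcal{C}(\triangle p_jp_kp_l)$ such that $p_i$ is the $\mathcal{C}$-orthocenter of $\triangle p_jp_kp_l$ associated with $x_i$. Here the points need not be distinct. *)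

theory Defs
  imports "HOL-Analysis.Analysis"
begin

definition point_symmetry :: "'a::real_vector \<Rightarrow> 'a \<Rightarrow> 'a" where
  "point_symmetry p w = 2 *\<^sub>R p - w"

definition circumcenters :: "'a::real_normed_vector \<Rightarrow> 'a \<Rightarrow> 'a \<Rightarrow> 'a set" where
  "circumcenters a b c = {x. norm (x - a) = norm (x - b) \<and> norm (x - b) = norm (x - c)}"

text \<open>The point of symmetry between the triangle \<open>abc\<close> and its \<open>u\<close>-antitriangle, whose vertices are
  the images of \<open>u\<close> under the symmetries at the midpoints of the sides.\<close>

definition antitriangle_center :: "'a::real_vector \<Rightarrow> 'a \<Rightarrow> 'a \<Rightarrow> 'a \<Rightarrow> 'a" where
  "antitriangle_center a b c u = (1/2) *\<^sub>R (a + b + c - u)"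

text \<open>Meant for \<open>u \<in> circumcenters a b c\<close>; the value is \<open>a + b + c - 2u\<close>.\<close>

definition C_orthocenter :: "'a::real_vector \<Rightarrow> 'a \<Rightarrow> 'a \<Rightarrow> 'a \<Rightarrow> 'a" where
  "C_orthocenter a b c u = point_symmetry (antitriangle_center a b c u) u"

text \<open>A system of four, not necessarily distinct, points is the family \<open>p 1, p 2, p 3, p 4\<close>; the
  values of \<open>p\<close> at other indices are irrelevant.\<close>

definition C_orthocentric_system :: "(nat \<Rightarrow> 'a::real_normed_vector) \<Rightarrow> bool" where
  "C_orthocentric_system p \<longleftrightarrow>
     (\<exists>i j k l. {i, j, k, l} = {1, 2, 3, 4} \<and>
        (\<exists>u \<in> circumcenters (p j) (p k) (p l). p i = C_orthocenter (p j) (p k) (p l) u))"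

end

theory Submission
  imports Defs
begin

text \<open>Since \<open>x 4 - p i = x i - p 4\<close>, the point \<open>x 4\<close> is a circumcenter of the antitriangle with the
  same radius \<open>r\<close>, and \<open>p 4\<close> is the associated orthocenter. Likewise
  \<open>q - m i = (x i - p 4) / 2 = d i - q\<close>, so all six midpoints are at distance \<open>r / 2\<close> from \<open>q\<close>.\<close>

lemma C_orthocenter_eq: "C_orthocenter a b c u = a + b + c - 2 *\<^sub>R u"
  by (simp add: C_orthocenter_def point_symmetry_def antitriangle_center_def scaleR_2)

lemma point_symmetry_midpoint: "point_symmetry (midpoint a b) u = a + b - u"
  by (simp add: point_symmetry_def midpoint_def)

text \<open>Fixes the labeling with index 4 as the orthocenter, which suits both \<open>x\<close>
  and \<open>p\<close>.\<close>

lemma C_orthocentric_systemI: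
  assumes "u \<in> circumcenters (p 1) (p 2) (p 3)" "p 4 = C_orthocenter (p 1) (p 2) (p 3) u"
  shows "C_orthocentric_system p"
  unfolding C_orthocentric_system_def
  by (rule exI[of _ 4], rule exI[of _ 1], rule exI[of _ 2], rule exI[of _ 3]) (use assms in auto)

lemma circumcenter_antitriangle:
  assumes "u \<in> circumcenters a b c"
  shows "C_orthocenter a b c u \<in> circumcenters (b + c - u) (a + c - u) (a + b - u)"
proof -
  have "C_orthocenter a b c u - (b + c - u) = a - u"
    "C_orthocenter a b c u - (a + c - u) = b - u"
    "C_orthocenter a b c u - (a + b - u) = c - u"
    by (simp_all add: C_orthocenter_eq scaleR_2)
  with assms show ?thesis
    by (simp add: circumcenters_def norm_minus_commute)
qed

text \<open>The three vertices sum to \<open>2 *\<^sub>R (a + b + c) - 3 *\<^sub>R u\<close>;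
  subtracting twice \<open>a + b + c - 2 *\<^sub>R u\<close> leaves \<open>u\<close>.\<close>

lemma C_orthocenter_antitriangle:
  "C_orthocenter (b + c - u) (a + c - u) (a + b - u) (C_orthocenter a b c u) = u"
  by (simp add: C_orthocenter_eq scaleR_2)

text \<open>Both pairs of endpoints have the sum
  \<open>2 *\<^sub>R a + b + c - 2 *\<^sub>R u\<close>.\<close>

lemma midpoint_antitriangle:
  "midpoint (a + c - u) (a + b - u) = midpoint a (C_orthocenter a b c u)"
  by (simp add: midpoint_def C_orthocenter_eq scaleR_2)

lemma dist_antitriangle_center_midpoint:
  "dist (antitriangle_center a b c u) (midpoint b c) = norm (u - a) / 2"
proof -
  have "antitriangle_center a b c u - midpoint b c = (1/2) *\<^sub>R (a - u)"
    by (simp add: antitriangle_center_def midpoint_def flip: scaleR_diff_right)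
  then show ?thesis
    by (simp add: dist_norm norm_minus_commute)
qed

text \<open>The center is itself the midpoint of \<open>u\<close> and the orthocenter, so the
  orthocenter cancels in the difference.\<close>

lemma dist_antitriangle_center_orthocenter_midpoint:
  "dist (antitriangle_center a b c u) (midpoint a (C_orthocenter a b c u)) = norm (u - a) / 2"
proof -
  have "antitriangle_center a b c u - midpoint a (C_orthocenter a b c u)
      = (1/2) *\<^sub>R ((a + b + c - u) - (a + C_orthocenter a b c u))"
    by (simp add: antitriangle_center_def midpoint_def flip: scaleR_diff_right)
  also have "\<dots> = (1/2) *\<^sub>R (u - a)"
    by (simp add: C_orthocenter_eq scaleR_2)
  finally show ?thesis
    by (simp add: dist_norm)
qed

theorem corollary3p3:
  fixes x p m d :: "nat \<Rightarrow> 'a::real_normed_vector" and q :: 'a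
  assumes plane: "dim (UNIV :: 'a set) = 2"
    and p4: "p 4 \<in> circumcenters (x 1) (x 2) (x 3)"
    and m: "m 1 = midpoint (x 2) (x 3)" "m 2 = midpoint (x 1) (x 3)" "m 3 = midpoint (x 1) (x 2)"
    and p: "\<And>i. i \<in> {1, 2, 3} \<Longrightarrow> p i = point_symmetry (m i) (p 4)"
    and q: "q = antitriangle_center (x 1) (x 2) (x 3) (p 4)"
    and x4: "x 4 = point_symmetry q (p 4)"
    and d: "d 1 = midpoint (p 2) (p 3)" "d 2 = midpoint (p 1) (p 3)" "d 3 = midpoint (p 1) (p 2)"
  shows "(C_orthocentric_system x \<and> C_orthocentric_system p)
    \<and> (x 4 = C_orthocenter (x 1) (x 2) (x 3) (p 4)
        \<and> (\<forall>i \<in> {1, 2, 3}. d i = midpoint (x i) (x 4)))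
    \<and> {m 1, m 2, m 3, d 1, d 2, d 3} \<subseteq> sphere q (norm (q - m 1))"
proof -
  let ?a = "x 1" and ?b = "x 2" and ?c = "x 3" and ?u = "p 4"
  have ps: "p 1 = ?b + ?c - ?u" "p 2 = ?a + ?c - ?u" "p 3 = ?a + ?b - ?u"
    using p by (simp_all add: m point_symmetry_midpoint del: One_nat_def)
  have x4': "x 4 = C_orthocenter ?a ?b ?c ?u"
    by (simp add: x4 q C_orthocenter_def)
  \<comment> \<open>The midpoint lemmas single out the first vertex. Symmetry of \<open>q\<close>
    and \<open>x 4\<close> in the three vertices lets the second or third be listed first.\<close>
  have perm: "q = antitriangle_center ?b ?a ?c ?u" "q = antitriangle_center ?c ?a ?b ?u"
    "x 4 = C_orthocenter ?b ?a ?c ?u" "x 4 = C_orthocenter ?c ?a ?b ?u"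
    by (simp_all add: q x4' antitriangle_center_def C_orthocenter_eq ac_simps)
  have "C_orthocentric_system x"
    using p4 x4' by (rule C_orthocentric_systemI)
  moreover have "C_orthocentric_system p"
    \<comment> \<open>The roles are exchanged: \<open>x 4\<close> is now the circumcenter and
      \<open>p 4\<close> the orthocenter.\<close>
    by (rule C_orthocentric_systemI[of "x 4"])
      (simp_all only: ps x4' circumcenter_antitriangle[OF p4] C_orthocenter_antitriangle)
  moreover have ds: "d 1 = midpoint ?a (x 4)" "d 2 = midpoint ?b (x 4)" "d 3 = midpoint ?c (x 4)"
    \<comment> \<open>The arguments follow the order of occurrence \<open>a\<close>,
      \<open>c\<close>, \<open>u\<close>, \<open>b\<close> in the lemma, so the distinguished vertex
      comes first.\<close>
    using midpoint_antitriangle[of ?a ?c ?u ?b] midpoint_antitriangle[of ?b ?c ?u ?a]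
      midpoint_antitriangle[of ?c ?b ?u ?a]
    by (simp_all only: d ps x4'[symmetric] perm(3,4)[symmetric] add.commute)
  moreover have "dist q (m 1) = norm (?u - ?a) / 2" "dist q (m 2) = norm (?u - ?b) / 2"
      "dist q (m 3) = norm (?u - ?c) / 2"
    using dist_antitriangle_center_midpoint[of ?a ?b ?c ?u]
      dist_antitriangle_center_midpoint[of ?b ?a ?c ?u]
      dist_antitriangle_center_midpoint[of ?c ?a ?b ?u]
    by (simp_all only: m q[symmetric] perm(1,2)[symmetric])
  moreover have "dist q (d 1) = norm (?u - ?a) / 2" "dist q (d 2) = norm (?u - ?b) / 2"
      "dist q (d 3) = norm (?u - ?c) / 2"
    using dist_antitriangle_center_orthocenter_midpoint[of ?a ?b ?c ?u]
      dist_antitriangle_center_orthocenter_midpoint[of ?b ?a ?c ?u]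
      dist_antitriangle_center_orthocenter_midpoint[of ?c ?a ?b ?u]
    by (simp_all only: ds q[symmetric] x4'[symmetric] perm[symmetric])
  ultimately show ?thesis
    \<comment> \<open>By \<open>p4\<close> the three values \<open>norm (?u - ?a) / 2\<close>,
      \<open>norm (?u - ?b) / 2\<close>, \<open>norm (?u - ?c) / 2\<close> agree, and the first is
      the radius \<open>norm (q - m 1)\<close>.\<close>
    using p4 x4' by (auto simp: circumcenters_def dist_norm)
qed

end
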